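(* Fix an integer $k\ge1$ and a symmetric positive definite matrix $\Sigma_0=\begin{pmatrix}\Sigma_{11}&\Sigma_{12}\\ \Sigma_{21}&\Sigma_{22}\end{pmatrix}\in\mathbb{R}^{2k\times 2k}$ with $k\times k$ blocks, and let $d>0$. With $\mathcal{C}_0$, $\mathcal{C}_1$ and $D_{\mathrm{TV}}$ as defined in the context, $$\inf_{f\in\mathcal{C}_0,\;g\in\mathcal{C}_1}D_{\mathrm{TV}}(f,g)\le F_{\chi^2_1}\left(\frac d4\right),$$ where $F_{\chi^2_1}$ is the cumulative distribution function of the chi-square distribution with one degree of freedom.
   Context: For $\Delta\in\mathbb{R}$ and $\mu\in\mathbb{R}^k$ let $\phi_{\Delta,\mu}$ be the density on $\mathbb{R}^{2k}$ of the normal distribution $N(\mathrm{vec}(\mu a_\Delta'),\Sigma_0)$, where $a_\Delta=(\Delta,1)'$ (so the mean is the stacked vector $(\Delta\mu',\mu')'$). Convex hull under the null: $\mathcal{C}_0=\{\sum_{i=1}^m c_i\phi_{0,\mu_i}: m\in\mathbb{N},\ c_i\ge0,\ \sum_i c_i=1,\ \mu_i\in\mathbb{R}^k\}$. Convex hull under the alternative: $\mathcal{C}_1=\{\sum_{j=1}^m c_j\phi_{\Delta_j,\mu_j}: m\in\mathbb{N},\ c_j\ge0,\ \sum_j c_j=1,\ \Delta_j\in\mathbb{R},\ \mu_j\in\mathbb{R}^k,\ \Delta_j^2\mu_j'\Sigma_{11}^{-1}\mu_j\ge d\}$. Total variation distance: $D_{\mathrm{TV}}(f,g)=\frac12\int_{\mathbb{R}^{2k}}|f(r)-g(r)|\,dr$.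 *)

theory Defs
  imports "HOL-Probability.Probability"
begin

text \<open>The space of dimension \<open>2k\<close> is \<^typ>\<open>real ^ ('k + 'k)\<close> with \<open>k = CARD('k)\<close>: the index
  \<open>Inl i\<close> is the \<open>i\<close>-th coordinate and \<open>Inr i\<close> the \<open>(k + i)\<close>-th.\<close>

definition stack :: "real ^ 'k \<Rightarrow> real ^ 'k \<Rightarrow> real ^ ('k::finite + 'k)" where
  "stack u v = (\<chi> p. case p of Inl i \<Rightarrow> u $ i | Inr i \<Rightarrow> v $ i)"

definition block11 :: "real ^ ('k::finite + 'k) ^ ('k + 'k) \<Rightarrow> real ^ 'k ^ 'k" where
  "block11 S = (\<chi> i j. S $ Inl i $ Inl j)"

definition symmetric_pos_def :: "real ^ 'n ^ 'n \<Rightarrow> bool" where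
  "symmetric_pos_def S \<longleftrightarrow> transpose S = S \<and> (\<forall>x. x \<noteq> 0 \<longrightarrow> x \<bullet> (S *v x) > 0)"

definition mvn_density :: "real ^ 'n \<Rightarrow> real ^ 'n ^ 'n \<Rightarrow> real ^ 'n \<Rightarrow> real" where
  "mvn_density m S r =
     exp (- ((r - m) \<bullet> (matrix_inv S *v (r - m))) / 2) / sqrt ((2 * pi) ^ CARD('n) * det S)"

text \<open>With \<open>a = (\<Delta>, 1)'\<close>, the columns of \<open>\<mu> a'\<close> are \<open>\<Delta> \<mu>\<close> and \<open>\<mu>\<close>, so its vectorization is
  \<open>stack (\<Delta> \<mu>) \<mu>\<close>.\<close>

definition phi :: "real ^ ('k::finite + 'k) ^ ('k + 'k) \<Rightarrow> real \<Rightarrow> real ^ 'k \<Rightarrow> real ^ ('k + 'k) \<Rightarrow> real" where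
  "phi S0 \<Delta> \<mu> = mvn_density (stack (\<Delta> *\<^sub>R \<mu>) \<mu>) S0"

definition C0 :: "real ^ ('k::finite + 'k) ^ ('k + 'k) \<Rightarrow> (real ^ ('k + 'k) \<Rightarrow> real) set" where
  "C0 S0 = {\<lambda>r. \<Sum>i<m. c i * phi S0 0 (\<mu> i) r | (m :: nat) c \<mu>.
     (\<forall>i<m. c i \<ge> 0) \<and> (\<Sum>i<m. c i) = 1}"

definition C1 :: "real ^ ('k::finite + 'k) ^ ('k + 'k) \<Rightarrow> real \<Rightarrow> (real ^ ('k + 'k) \<Rightarrow> real) set" where
  "C1 S0 d = {\<lambda>r. \<Sum>j<m. c j * phi S0 (\<Delta> j) (\<mu> j) r | (m :: nat) c \<Delta> \<mu>.
     (\<forall>j<m. c j \<ge> 0) \<and> (\<Sum>j<m. c j) = 1 \<and>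
     (\<forall>j<m. (\<Delta> j)\<^sup>2 * (\<mu> j \<bullet> (matrix_inv (block11 S0) *v \<mu> j)) \<ge> d)}"

definition D_TV :: "(real ^ 'n \<Rightarrow> real) \<Rightarrow> (real ^ 'n \<Rightarrow> real) \<Rightarrow> real" where
  "D_TV f g = (1 / 2) * (LINT r|lborel. \<bar>f r - g r\<bar>)"

definition chi_square :: "nat \<Rightarrow> real measure" where
  "chi_square n = distr (Pi\<^sub>M {..<n} (\<lambda>_. density lborel std_normal_density)) borel
     (\<lambda>z. \<Sum>i<n. (z i)\<^sup>2)"

end

theory Submission
  imports Defs
begin

text \<open>Already a single pair of densities suffices. Pick \<open>x\<close> with \<open>x' \<Sigma>11 x = d\<close>, let
  \<open>\<delta> = \<Sigma>0 (x', 0')' = (v', w')'\<close> with \<open>v = \<Sigma>11 x\<close>, and compare the null mean \<open>(0, v - w)\<close> with the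
  alternative mean \<open>(v, v)\<close>, i.e. \<open>\<Delta> = 1\<close>, \<open>\<mu> = v\<close>. The means differ by \<open>\<delta>\<close>, whose squared Mahalanobis
  norm is \<open>\<delta>' \<Sigma>0^{-1} \<delta> = x' \<Sigma>11 x = d\<close>, the smallest value the constraint allows. In coordinates
  that are orthonormal for \<open>\<Sigma>0^{-1}\<close> and have \<open>\<delta> / sqrt d\<close> as first basis vector, both densities are
  products of standard normal densities that differ only by a shift of the first factor by
  \<open>s = sqrt d\<close>. The total variation distance is therefore that of \<open>N(0,1)\<close> and \<open>N(s,1)\<close>, namely
  \<open>P(-s/2 < Z \<le> s/2) = P(Z^2 \<le> d/4)\<close>.\<close>

section \<open>Linear substitutions in Lebesgue integrals\<close>

text \<open>On each line parallel to \<open>b\<close> the function \<open>g\<close> is constant, so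
  the map acts there as a translation, which preserves one-dimensional Lebesgue measure. Integrating
  over the remaining coordinates finishes the argument.\<close>

lemma nn_integral_lborel_shear:
  fixes b :: "'a::euclidean_space"
  assumes b: "b \<in> Basis"
    and f [measurable]: "f \<in> borel_measurable borel"
    and g [measurable]: "g \<in> borel_measurable borel"
    and g_inv: "\<And>x t. g (x + t *\<^sub>R b) = g x"
  shows "(\<integral>\<^sup>+x. f (x + g x *\<^sub>R b) \<partial>lborel) = (\<integral>\<^sup>+x. f x \<partial>lborel)"
proof -
  interpret product_sigma_finite "\<lambda>_::'a. lborel :: real measure" by standard
  let ?B = "Basis - {b}"
  define s where "s x = (\<Sum>c\<in>?B. x c *\<^sub>R c)" for x :: "'a \<Rightarrow> real"
  have Basis_eq: "insert b ?B = Basis" using b by blast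
  have sum_eq: "(\<Sum>c\<in>Basis. (x(b := y)) c *\<^sub>R c) = s x + y *\<^sub>R b" for x :: "'a \<Rightarrow> real" and y
    unfolding s_def by (subst sum.remove[OF finite_Basis b]) (auto intro!: sum.cong)
  have *: "(\<integral>\<^sup>+x. h x \<partial>lborel) = (\<integral>\<^sup>+x. (\<integral>\<^sup>+y. h (s x + y *\<^sub>R b) \<partial>lborel) \<partial>Pi\<^sub>M ?B (\<lambda>_. lborel))"
    if [measurable]: "h \<in> borel_measurable borel" for h :: "'a \<Rightarrow> ennreal"
  proof -
    have "(\<integral>\<^sup>+x. h x \<partial>lborel)
        = (\<integral>\<^sup>+x. h (\<Sum>c\<in>Basis. x c *\<^sub>R c) \<partial>Pi\<^sub>M (insert b ?B) (\<lambda>_. lborel))"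
      unfolding Basis_eq
      by (subst lborel_eq) (simp add: nn_integral_distr)
    also have "\<dots> = (\<integral>\<^sup>+x. (\<integral>\<^sup>+y. h (s x + y *\<^sub>R b) \<partial>lborel) \<partial>Pi\<^sub>M ?B (\<lambda>_. lborel))"
      unfolding sum_eq[symmetric] by (rule product_nn_integral_insert) (auto simp: Basis_eq)
    finally show ?thesis .
  qed
  have "(\<integral>\<^sup>+y. f (s x + y *\<^sub>R b + g (s x + y *\<^sub>R b) *\<^sub>R b) \<partial>lborel) = (\<integral>\<^sup>+y. f (s x + y *\<^sub>R b) \<partial>lborel)" for x
    using nn_integral_real_affine[of "\<lambda>y. f (s x + y *\<^sub>R b)" 1 "g (s x)"]
    by (simp add: g_inv algebra_simps)
  then show ?thesis
    by (simp add: *)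
qed

lemma Basis_cart: "(Basis :: (real^'n) set) = range (\<lambda>i. axis i 1)"
  by (auto simp: Basis_vec_def)

lemma inj_axis: "inj (\<lambda>i::'n::finite. axis i (1::real))"
  by (auto simp: inj_def axis_eq_axis)

text \<open>Lebesgue measure is determined by its values on boxes, and a permutation of coordinates
  pulls a box back to a box with the same side lengths in another order.\<close>

lemma lborel_distr_permute:
  fixes p :: "'n::finite \<Rightarrow> 'n"
  assumes "p permutes UNIV"
  shows "distr lborel borel (\<lambda>x::real^'n. \<chi> i. x $ p i) = lborel"
proof (rule lborel_eqI[symmetric])
  let ?T = "\<lambda>x::real^'n. \<chi> i. x $ p i" and ?R = "\<lambda>x::real^'n. \<chi> i. x $ inv p i"
  have T [measurable]: "?T \<in> borel \<rightarrow>\<^sub>M borel"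
    by (intro borel_measurable_continuous_onI continuous_intros)
  fix l u :: "real^'n" assume le: "\<And>b. b \<in> Basis \<Longrightarrow> l \<bullet> b \<le> u \<bullet> b"
  have le': "l $ i \<le> u $ i" for i
    using le[of "axis i 1"] by (simp add: cart_eq_inner_axis)
  have Basis: "(\<Prod>b\<in>Basis. h b) = (\<Prod>i\<in>UNIV. h (axis i 1))" for h :: "real^'n \<Rightarrow> real"
    unfolding Basis_cart prod.reindex[OF inj_axis] by simp
  have ip: "inv p permutes UNIV" by (rule permutes_inv[OF assms])
  have "?T -` box l u = box (?R l) (?R u)"
    by (auto simp: mem_box_cart) (metis assms permutes_inverses)+
  then have "emeasure (distr lborel borel ?T) (box l u) = emeasure lborel (box (?R l) (?R u))"
    by (simp add: emeasure_distr)
  also have "\<dots> = (\<Prod>b\<in>Basis. (?R u - ?R l) \<bullet> b)"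
    by (rule emeasure_lborel_box) (auto simp: Basis_vec_def inner_axis le')
  also have "(\<Prod>b\<in>Basis. (?R u - ?R l) \<bullet> b) = (\<Prod>i\<in>UNIV. (u - l) $ inv p i)"
    by (simp add: Basis inner_axis)
  also have "\<dots> = (\<Prod>i\<in>UNIV. (u - l) $ i)"
    by (rule prod.permute[OF ip, unfolded o_def, symmetric])
  also have "\<dots> = (\<Prod>b\<in>Basis. (u - l) \<bullet> b)"
    by (simp add: Basis inner_axis)
  finally show "emeasure (distr lborel borel ?T) (box l u) = (\<Prod>b\<in>Basis. (u - l) \<bullet> b)" .
qed simp

lemma borel_measurable_matrix_vector_mult [measurable]:
  "(\<lambda>x. A *v x) \<in> borel_measurable (borel :: (real^'n) measure)" for A :: "real^'n^'m"
  by (intro borel_measurable_continuous_onI linear_continuous_on linear_linear[THEN iffD2]) simp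

text \<open>The library's change of variables for linear maps requires a well-ordered index type,
  which a sum type such as \<open>'k + 'k\<close> is not; hence the detour through elementary matrices.\<close>

lemma nn_integral_lborel_matrix:
  fixes A :: "real^'n^'n"
  assumes "det A \<noteq> 0" "f \<in> borel_measurable borel"
  shows "ennreal \<bar>det A\<bar> * (\<integral>\<^sup>+x. f (A *v x) \<partial>lborel) = (\<integral>\<^sup>+x. f x \<partial>lborel)"
proof -
  \<comment> \<open>The integrand is quantified inside the predicate because the product case
    applies the hypothesis for \<open>B\<close> to \<open>f\<close> composed with \<open>A\<close>.
    The premise on the determinant makes the case of a zero row vacuous.\<close>
  let ?P = "\<lambda>A :: real^'n^'n. det A \<noteq> 0 \<longrightarrow> (\<forall>f \<in> borel_measurable borel.
      ennreal \<bar>det A\<bar> * (\<integral>\<^sup>+x. f (A *v x) \<partial>lborel) = (\<integral>\<^sup>+x. f x \<partial>lborel))"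
  have "?P A"
  proof (rule induct_matrix_elementary[where P = ?P])
    fix A B :: "real^'n^'n"
    assume A: "?P A" and B: "?P B"
    show "?P (A ** B)"
    proof (intro impI ballI)
      fix f :: "real^'n \<Rightarrow> ennreal" assume [measurable]: "f \<in> borel_measurable borel"
      assume nz: "det (A ** B) \<noteq> 0"
      have "ennreal \<bar>det (A ** B)\<bar> * (\<integral>\<^sup>+x. f ((A ** B) *v x) \<partial>lborel)
        = ennreal \<bar>det A\<bar> * (ennreal \<bar>det B\<bar> * (\<integral>\<^sup>+x. f (A *v (B *v x)) \<partial>lborel))"
        by (simp add: det_mul abs_mult ennreal_mult mult.assoc matrix_vector_mul_assoc)
      also have "ennreal \<bar>det B\<bar> * (\<integral>\<^sup>+x. f (A *v (B *v x)) \<partial>lborel) = (\<integral>\<^sup>+x. f (A *v x) \<partial>lborel)"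
        using B nz by (intro bspec[where x = "\<lambda>x. f (A *v x)"]) (auto simp: det_mul)
      also have "ennreal \<bar>det A\<bar> * \<dots> = (\<integral>\<^sup>+x. f x \<partial>lborel)"
        using A nz by (auto simp: det_mul)
      finally show "ennreal \<bar>det (A ** B)\<bar> * (\<integral>\<^sup>+x. f ((A ** B) *v x) \<partial>lborel) = (\<integral>\<^sup>+x. f x \<partial>lborel)" .
    qed
  next
    fix A :: "real^'n^'n" and i assume "row i A = 0"
    then show "?P A" using det_zero_row(2) by blast
  next
    fix A :: "real^'n^'n" assume diag: "\<And>i j. i \<noteq> j \<Longrightarrow> A $ i $ j = 0"
    show "?P A"
    proof (intro impI ballI)
      fix f :: "real^'n \<Rightarrow> ennreal" assume [measurable]: "f \<in> borel_measurable borel"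
      assume nz: "det A \<noteq> 0"
      \<comment> \<open>The diagonal entries are indexed by basis vectors to match
        \<open>lborel_affine_euclidean\<close>, which scales each axis separately.\<close>
      define c where "c b = b \<bullet> (A *v b)" for b
      have c: "c (axis i 1) = A $ i $ i" for i
        by (simp add: c_def matrix_vector_mult_basis inner_axis' column_def)
      have det: "det A = (\<Prod>b\<in>Basis. c b)"
        by (simp add: det_diagonal[OF diag] Basis_cart prod.reindex inj_axis c)
      have Ax: "A *v x = 0 + (\<Sum>j\<in>Basis. (c j * (x \<bullet> j)) *\<^sub>R j)" for x
      proof -
        have "(\<Sum>j\<in>UNIV. A $ i $ j * x $ j) = A $ i $ i * x $ i" for i
          by (subst sum.remove[of _ i]) (auto simp: diag)
        then have "A *v x = (\<chi> i. A $ i $ i * x $ i)"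
          by (simp add: matrix_vector_mult_def)
        also have "\<dots> = (\<Sum>j\<in>Basis. (c j * (x \<bullet> j)) *\<^sub>R j)"
          unfolding Basis_cart sum.reindex[OF inj_axis] o_def c inner_axis
          by (simp add: vec_eq_iff axis_def if_distrib cong: if_cong)
        finally show ?thesis by simp
      qed
      have "(\<integral>\<^sup>+x. f x \<partial>lborel)
         = (\<integral>\<^sup>+x. f x \<partial>density (distr lborel borel (\<lambda>x. A *v x)) (\<lambda>_. \<Prod>j\<in>Basis. \<bar>c j\<bar>))"
        unfolding Ax using nz by (subst lborel_affine_euclidean[of c 0]) (auto simp: det)
      also have "\<dots> = ennreal \<bar>det A\<bar> * (\<integral>\<^sup>+x. f (A *v x) \<partial>lborel)"
        by (simp add: nn_integral_density nn_integral_distr nn_integral_cmult det abs_prod prod_nonneg)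
      finally show "ennreal \<bar>det A\<bar> * (\<integral>\<^sup>+x. f (A *v x) \<partial>lborel) = (\<integral>\<^sup>+x. f x \<partial>lborel)" ..
    qed
  next
    fix m n :: 'n assume "m \<noteq> n"
    let ?p = "Transposition.transpose m n"
    let ?A = "\<chi> i j. mat 1 $ i $ ?p j :: real^'n^'n"
    have p: "?p permutes UNIV" by (simp add: permutes_swap_id)
    \<comment> \<open>The determinant of a transposition is -1, but only its absolute value enters
      the substitution formula.\<close>
    have det: "\<bar>det ?A\<bar> = 1"
      by (simp add: det_permute_columns[OF p] abs_mult sign_swap_id \<open>m \<noteq> n\<close>)
    have "(\<Sum>j\<in>UNIV. (if i = ?p j then x $ j else 0)) = x $ ?p i" for x :: "real^'n" and i
    proof -
      have "(\<Sum>j\<in>UNIV. (if i = ?p j then x $ j else 0)) = (\<Sum>j\<in>UNIV. (if j = ?p i then x $ j else 0))"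
        by (intro sum.cong) (auto simp: transpose_eq_iff)
      then show ?thesis by simp
    qed
    then have Ax: "?A *v x = (\<chi> i. x $ ?p i)" for x
      by (simp add: matrix_vector_mult_def mat_def if_distrib[of "\<lambda>t. t * _"] cong: if_cong)
    have "(\<integral>\<^sup>+x. f (\<chi> i. x $ ?p i) \<partial>lborel) = (\<integral>\<^sup>+x. f x \<partial>lborel)"
      if [measurable]: "f \<in> borel_measurable borel" for f :: "real^'n \<Rightarrow> ennreal"
    proof -
      have [measurable]: "(\<lambda>x::real^'n. \<chi> i. x $ ?p i) \<in> borel \<rightarrow>\<^sub>M borel"
        by (intro borel_measurable_continuous_onI continuous_intros)
      show ?thesis
        by (subst (2) lborel_distr_permute[OF p, symmetric]) (simp add: nn_integral_distr)
    qed
    then show "?P ?A" unfolding Ax det by auto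
  next
    fix m n :: 'n and c :: real assume mn: "m \<noteq> n"
    let ?A = "\<chi> i j. if i = m \<and> j = n then c else of_bool (i = j) :: real^'n^'n"
    \<comment> \<open>The matrix arises from the identity by adding a multiple of one row to
      another, which leaves the determinant at 1.\<close>
    have "?A = (\<chi> k. if k = m then row m (mat 1) + c *s row n (mat 1) else row k (mat 1))"
      using mn by (auto simp: vec_eq_iff row_def mat_def)
    then have det: "det ?A = 1"
      using det_row_operation[OF mn, of "mat 1" c] by simp
    have "(\<Sum>j\<in>UNIV. (if i = m \<and> j = n then c else of_bool (i = j)) * x $ j)
       = x $ i + (c * x $ n) * (axis m 1 $ i)" for x :: "real^'n" and i
    proof -
      have "(\<Sum>j\<in>UNIV. (if i = m \<and> j = n then c else of_bool (i = j)) * x $ j)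
        = (\<Sum>j\<in>UNIV. (if j = i then x $ j else 0) + (if j = n then c * x $ j * (axis m 1 $ i) else 0))"
        using mn by (intro sum.cong) (auto simp: axis_def)
      then show ?thesis by (simp add: sum.distrib)
    qed
    then have Ax: "?A *v x = x + (c * x $ n) *\<^sub>R axis m 1" for x
      by (simp add: matrix_vector_mult_def vec_eq_iff)
    have "(\<integral>\<^sup>+x. f (?A *v x) \<partial>lborel) = (\<integral>\<^sup>+x. f x \<partial>lborel)"
      if [measurable]: "f \<in> borel_measurable borel" for f :: "real^'n \<Rightarrow> ennreal"
    proof -
      \<comment> \<open>Moving along axis \<open>m\<close> does not change coordinate
        \<open>n\<close>; this is the invariance that the shear lemma asks of its
        coefficient.\<close>
      have "axis m (1::real) $ n = 0" using mn by (simp add: axis_def)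
      then show ?thesis
        unfolding Ax
        by (intro nn_integral_lborel_shear)
           (auto intro!: borel_measurable_continuous_onI continuous_intros)
    qed
    then show "?P ?A" by (simp add: det)
  qed
  with assms show ?thesis by blast
qed

section \<open>Positive definite matrices and orthonormal coordinates\<close>

lemma inner_matrix_vector_left: "(A *v x) \<bullet> y = x \<bullet> (transpose A *v y)" for A :: "real^'n^'m"
  by (metis dot_lmul_matrix vector_transpose_matrix transpose_transpose)

lemma symmetric_pos_def_invertible:
  assumes "symmetric_pos_def S" shows "invertible S"
proof -
  have "x = 0" if "S *v x = 0" for x
    using assms that unfolding symmetric_pos_def_def by (metis inner_zero_right less_irrefl)
  then show ?thesis
    by (simp add: invertible_left_inverse matrix_left_invertible_ker)
qed

lemma
  fixes S :: "real^'n^'n"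
  assumes "invertible S"
  shows matrix_inv_left: "matrix_inv S ** S = mat 1"
    and matrix_inv_right: "S ** matrix_inv S = mat 1"
  using someI_ex[OF assms[unfolded invertible_def]] by (simp_all add: matrix_inv_def)

lemma matrix_inv_vector_mult:
  fixes S :: "real^'n^'n" and x :: "real^'n"
  assumes "invertible S"
  shows "matrix_inv S *v (S *v x) = x" "S *v (matrix_inv S *v x) = x"
  using assms by (simp_all add: matrix_vector_mul_assoc matrix_inv_left matrix_inv_right)

text \<open>The substitution \<open>x = S *v y\<close> turns the quadratic form of the inverse at
  \<open>x\<close> into that of \<open>S\<close> at \<open>y\<close>. For symmetry, the transposed
  inverse is again a left inverse of \<open>S\<close>.\<close>

lemma symmetric_pos_def_matrix_inv:
  fixes S :: "real^'n^'n"
  assumes "symmetric_pos_def S" shows "symmetric_pos_def (matrix_inv S)"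
  unfolding symmetric_pos_def_def
proof (intro conjI allI impI)
  have inv: "invertible S" by (rule symmetric_pos_def_invertible[OF assms])
  have tr: "transpose S = S" using assms by (simp add: symmetric_pos_def_def)
  have "transpose (matrix_inv S) ** S = mat 1"
    by (metis matrix_inv_right[OF inv] matrix_transpose_mul tr transpose_mat)
  then show "transpose (matrix_inv S) = matrix_inv S"
    by (metis matrix_inv_right[OF inv] matrix_mul_assoc matrix_mul_lid matrix_mul_rid)
  fix x :: "real^'n" assume "x \<noteq> 0"
  define y where "y = matrix_inv S *v x"
  have x: "x = S *v y" by (simp add: y_def matrix_inv_vector_mult[OF inv])
  with \<open>x \<noteq> 0\<close> have "y \<noteq> 0" by auto
  then have "y \<bullet> (S *v y) > 0" using assms by (simp add: symmetric_pos_def_def)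
  then show "x \<bullet> (matrix_inv S *v x) > 0"
    unfolding y_def[symmetric] by (simp add: x inner_commute)
qed

text \<open>The columns of \<open>A\<close> are a maximal \<open>P\<close>-orthonormal set containing \<open>v\<close>.\<close>

lemma orthonormal_matrix_extension:
  fixes P :: "real^'n^'n"
  assumes P: "symmetric_pos_def P" and v: "v \<bullet> (P *v v) = 1"
  obtains A :: "real^'n^'n" and p where "A *v axis p 1 = v" "transpose A ** P ** A = mat 1"
proof -
  \<comment> \<open>\<open>Q\<close> is the inner product given by \<open>P\<close>; the facts that
    follow are what Gram-Schmidt needs.\<close>
  define Q where "Q x y = x \<bullet> (P *v y)" for x y
  have Q_add: "Q x (y + z) = Q x y + Q x z" and Q_scale: "Q x (c *\<^sub>R y) = c * Q x y"
    and Q_diff: "Q x (y - z) = Q x y - Q x z"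
    and Q_sum: "Q x (\<Sum>b\<in>B. h b) = (\<Sum>b\<in>B. Q x (h b))" for x y z c h and B :: "(real^'n) set"
    by (simp_all add: Q_def matrix_vector_right_distrib matrix_vector_mult_diff_distrib
        inner_add_right inner_diff_right matrix_vector_mult_scaleR
        linear_sum[OF matrix_vector_mul_linear] inner_sum_right)
  have Q_sym: "Q x y = Q y x" for x y
    using P unfolding Q_def symmetric_pos_def_def by (metis inner_matrix_vector_left inner_commute)
  have Q_pos: "Q x x > 0" if "x \<noteq> 0" for x
    using P that by (simp add: Q_def symmetric_pos_def_def)
  define OK where "OK B \<longleftrightarrow> finite B \<and> v \<in> B \<and> (\<forall>x\<in>B. \<forall>y\<in>B. Q x y = of_bool (x = y))" for B
  have indep: "independent B" if "OK B" for B
  proof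
    assume "dependent B"
    with that obtain u w where uw: "w \<in> B" "u w \<noteq> 0" "(\<Sum>x\<in>B. u x *\<^sub>R x) = 0"
      by (auto simp: OK_def dependent_finite)
    have "0 = Q w (\<Sum>x\<in>B. u x *\<^sub>R x)" by (simp add: uw Q_def)
    also have "\<dots> = (\<Sum>x\<in>B. if x = w then u x else 0)"
      unfolding Q_sum Q_scale using that uw by (intro sum.cong) (auto simp: OK_def)
    also have "\<dots> = u w" using that uw by (simp add: OK_def)
    finally show False using uw by simp
  qed
  have "OK {v}" using v by (simp add: OK_def Q_def)
  \<comment> \<open>Independence bounds the size of such sets by the dimension, so one of greatest
    cardinality exists.\<close>
  moreover have "\<forall>B. OK B \<longrightarrow> card B < Suc CARD('n)"
    using indep independent_bound by (fastforce simp: less_Suc_eq_le)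
  ultimately have "\<exists>B. OK B \<and> (\<forall>C. OK C \<longrightarrow> card C \<le> card B)"
    by (rule ex_has_greatest_nat)
  then obtain B where B: "OK B" and max: "\<And>C. OK C \<Longrightarrow> card C \<le> card B"
    by metis
  have fin: "finite B" and vB: "v \<in> B" and orth: "\<And>x y. x \<in> B \<Longrightarrow> y \<in> B \<Longrightarrow> Q x y = of_bool (x = y)"
    using B by (auto simp: OK_def)
  have "span B = UNIV"
  proof (rule ccontr)
    assume "span B \<noteq> UNIV"
    then obtain x where x: "x \<notin> span B" by blast
    \<comment> \<open>Gram-Schmidt: subtracting the \<open>Q\<close>-projection of \<open>x\<close>
      onto the span of \<open>B\<close> leaves a nonzero vector orthogonal to \<open>B\<close>, and
      its normalization \<open>z\<close> would enlarge \<open>B\<close>.\<close>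
    define y where "y = x - (\<Sum>b\<in>B. Q b x *\<^sub>R b)"
    have "(\<Sum>b\<in>B. Q b x *\<^sub>R b) \<in> span B"
      by (intro span_sum span_scale span_base)
    then have "y \<noteq> 0"
      using x by (auto simp: y_def)
    have Qy: "Q b y = 0" if "b \<in> B" for b
    proof -
      have "(\<Sum>c\<in>B. Q c x * Q b c) = (\<Sum>c\<in>B. if c = b then Q c x else 0)"
        using that by (intro sum.cong) (auto simp: orth)
      then show ?thesis
        using that fin by (simp add: y_def Q_diff Q_sum Q_scale)
    qed
    define z where "z = (1 / sqrt (Q y y)) *\<^sub>R y"
    have Qz: "Q b z = 0" "Q z b = 0" if "b \<in> B" for b
      using Qy[OF that] by (simp_all add: z_def Q_scale Q_sym[of _ b])
    have "Q z z = 1"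
      using Q_pos[OF \<open>y \<noteq> 0\<close>] by (simp add: z_def Q_scale Q_sym[of "_ *\<^sub>R _" y])
    then have "z \<notin> B" using Qz by force
    have "OK (insert z B)"
      using fin vB orth Qz \<open>Q z z = 1\<close> \<open>z \<notin> B\<close> by (auto simp: OK_def)
    from max[OF this] show False using \<open>z \<notin> B\<close> fin by simp
  qed
  then have "card B = CARD('n)"
    using indep[OF B] by (metis DIM_cart DIM_real dim_UNIV dim_eq_card_independent dim_span mult.right_neutral)
  \<comment> \<open>\<open>B\<close> has as many elements as there are indices, so its elements can
    serve as the columns of \<open>A\<close>, with \<open>v\<close> in column
    \<open>p\<close>.\<close>
  then obtain f where f: "bij_betw f (UNIV :: 'n set) B"
    using fin by (metis finite_class.finite_UNIV finite_same_card_bij)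
  then obtain p where p: "f p = v" using vB by (metis bij_betw_def imageE)
  define A where "A = (\<chi> i j. f j $ i)"
  have A: "A *v axis j 1 = f j" for j
    by (simp add: matrix_vector_mult_basis A_def column_def vec_eq_iff)
  have "(transpose A ** P ** A) $ i $ j = mat 1 $ i $ j" for i j
  proof -
    have "(transpose A ** P ** A) $ i $ j = axis i 1 \<bullet> ((transpose A ** P ** A) *v axis j 1)"
      by (simp add: matrix_vector_mult_basis inner_axis' column_def)
    also have "\<dots> = axis i 1 \<bullet> (transpose A *v (P *v f j))"
      by (simp add: matrix_vector_mul_assoc[symmetric] A)
    also have "\<dots> = Q (f i) (f j)"
      by (simp only: inner_matrix_vector_left[symmetric] A Q_def)
    also have "\<dots> = of_bool (i = j)"
      using f orth by (auto simp: bij_betw_def inj_eq)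
    finally show ?thesis by (simp add: mat_def)
  qed
  then have "transpose A ** P ** A = mat 1" by (simp add: vec_eq_iff)
  moreover have "A *v axis p 1 = v" by (simp only: A p)
  ultimately show ?thesis by (rule that[rotated])
qed

section \<open>Shifted normal densities on the line and the chi-square law\<close>

abbreviation std_normal_measure :: "real measure" where
  "std_normal_measure \<equiv> density lborel std_normal_density"

lemma integral_indicator_std_normal:
  assumes [measurable]: "A \<in> sets borel"
  shows "(\<integral>t. indicator A t * std_normal_density t \<partial>lborel) = measure std_normal_measure A"
proof -
  have "measure std_normal_measure A = (\<integral>t. indicator A t \<partial>std_normal_measure)"
    by simp
  also have "\<dots> = (\<integral>t. std_normal_density t *\<^sub>R indicator A t \<partial>lborel)"
    by (rule integral_density) auto
  finally show ?thesis by (simp add: mult.commute)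
qed

lemma integrable_indicator_std_normal:
  assumes [measurable]: "A \<in> sets borel"
  shows "integrable lborel (\<lambda>t. indicator A t * std_normal_density t)"
  using integrable_mult_indicator[of A lborel std_normal_density] by (simp add: integrable_normal_density)

text \<open>Each density decreases with the distance from its centre, so the comparison is decided
  by which of 0 and \<open>s\<close> is nearer to \<open>t\<close>; they are equally far at
  \<open>s / 2\<close>.\<close>

lemma std_normal_density_le_shift:
  assumes "s > 0"
  shows "std_normal_density (t - s) \<le> std_normal_density t \<longleftrightarrow> t \<le> s / 2"
proof -
  have "std_normal_density (t - s) \<le> std_normal_density t \<longleftrightarrow> t\<^sup>2 \<le> (t - s)\<^sup>2"
    by (simp add: std_normal_density_def divide_right_mono divide_le_cancel)
  also have "\<dots> \<longleftrightarrow> s * (2 * t) \<le> s * s"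
    by (simp add: power2_eq_square algebra_simps)
  also have "\<dots> \<longleftrightarrow> t \<le> s / 2"
    using assms by (simp only: mult_le_cancel_left_pos) auto
  finally show ?thesis .
qed

lemma
  assumes s: "s > 0"
  shows integrable_abs_std_normal_shift:
      "integrable lborel (\<lambda>t. \<bar>std_normal_density t - std_normal_density (t - s)\<bar>)"
    and integral_abs_std_normal_shift:
      "(\<integral>t. \<bar>std_normal_density t - std_normal_density (t - s)\<bar> \<partial>lborel)
        = 2 * measure std_normal_measure {- s / 2<..s / 2}"
proof -
  interpret N: prob_space std_normal_measure by (rule prob_space_normal_density) simp
  let ?g = "\<lambda>A t. indicator A t * std_normal_density t"
  \<comment> \<open>Since \<open>t \<le> s / 2\<close> means \<open>t - s \<le> - s / 2\<close>, all
    four indicators split the line at the crossing point of the densities. In this form each term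
    integrates, after a translation, to the probability of a half-line.\<close>
  have eq: "\<bar>std_normal_density t - std_normal_density (t - s)\<bar>
    = ?g {..s / 2} t - ?g {..- s / 2} (t - s) + ?g {- s / 2<..} (t - s) - ?g {s / 2<..} t" for t
    using std_normal_density_le_shift[OF s, of t]
    by (auto simp: indicator_def field_simps)
  have int: "integrable lborel (?g A)" "integrable lborel (\<lambda>t. ?g A (t - s))"
    if "A \<in> sets borel" for A
    using integrable_indicator_std_normal[OF that]
      lborel_integrable_real_affine[OF integrable_indicator_std_normal[OF that], of 1 "- s"]
    by simp_all
  have val: "(\<integral>t. ?g A t \<partial>lborel) = measure std_normal_measure A"
    "(\<integral>t. ?g A (t - s) \<partial>lborel) = measure std_normal_measure A"
    if "A \<in> sets borel" for A
    using integral_indicator_std_normal[OF that]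
      lborel_integral_real_affine[of 1 "?g A" "- s"]
    by simp_all
  show "integrable lborel (\<lambda>t. \<bar>std_normal_density t - std_normal_density (t - s)\<bar>)"
    unfolding eq by (intro Bochner_Integration.integrable_add Bochner_Integration.integrable_diff int) simp_all
  \<comment> \<open>Passing to complements of the upper tails reduces the four terms to twice the
    difference of two lower tails.\<close>
  have compl: "measure std_normal_measure {a<..} = 1 - measure std_normal_measure {..a}" for a
    using N.prob_compl[of "{..a}"] by (simp add: Compl_eq_Diff_UNIV[symmetric])
  have "{- s / 2<..s / 2} = {..s / 2} - {..- s / 2}" by auto
  then have "measure std_normal_measure {- s / 2<..s / 2}
    = measure std_normal_measure {..s / 2} - measure std_normal_measure {..- s / 2}"
    using s by (simp add: N.finite_measure_Diff)
  then show "(\<integral>t. \<bar>std_normal_density t - std_normal_density (t - s)\<bar> \<partial>lborel)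
        = 2 * measure std_normal_measure {- s / 2<..s / 2}"
    unfolding eq by (simp add: int val compl)
qed

text \<open>A product over a one-element index set is carried to its only factor by the coordinate
  projection.\<close>

lemma chi_square_1: "chi_square 1 = distr std_normal_measure borel (\<lambda>t. t\<^sup>2)"
proof -
  interpret N: prob_space std_normal_measure by (rule prob_space_normal_density) simp
  interpret product_sigma_finite "\<lambda>_::nat. std_normal_measure" by standard
  have "distr std_normal_measure borel (\<lambda>t. t\<^sup>2)
    = distr (distr (Pi\<^sub>M {0::nat} (\<lambda>_. std_normal_measure)) std_normal_measure (\<lambda>z. z 0)) borel (\<lambda>t. t\<^sup>2)"
    by (simp only: distr_singleton)
  also have "\<dots> = distr (Pi\<^sub>M {0} (\<lambda>_. std_normal_measure)) borel ((\<lambda>t. t\<^sup>2) \<circ> (\<lambda>z. z (0::nat)))"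
    by (rule distr_distr) auto
  also have "\<dots> = chi_square 1"
    by (simp add: chi_square_def o_def lessThan_Suc)
  finally show ?thesis ..
qed

text \<open>The half-open interval misses only the endpoint \<open>- s / 2\<close> of the preimage
  under squaring, and inclusion already gives the direction that an upper bound requires.\<close>

lemma measure_le_cdf_chi_square_1:
  assumes "s > 0"
  shows "measure std_normal_measure {- s / 2<..s / 2} \<le> cdf (chi_square 1) (s\<^sup>2 / 4)"
proof -
  interpret N: prob_space std_normal_measure by (rule prob_space_normal_density) simp
  have "t\<^sup>2 \<le> s\<^sup>2 / 4" if "- s / 2 < t" "t \<le> s / 2" for t
  proof -
    have "\<bar>t\<bar> \<le> \<bar>s / 2\<bar>" using that by arith
    then have "t\<^sup>2 \<le> (s / 2)\<^sup>2" by (simp only: abs_le_square_iff)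
    then show ?thesis by (simp add: power_divide)
  qed
  moreover have "(\<lambda>t::real. t\<^sup>2) -` {..s\<^sup>2 / 4} \<in> sets borel"
    using measurable_sets[of "\<lambda>t::real. t\<^sup>2" borel borel "{..s\<^sup>2 / 4}"] by simp
  ultimately have "measure std_normal_measure {- s / 2<..s / 2}
    \<le> measure std_normal_measure ((\<lambda>t. t\<^sup>2) -` {..s\<^sup>2 / 4})"
    by (intro N.finite_measure_mono) auto
  also have "\<dots> = cdf (chi_square 1) (s\<^sup>2 / 4)"
    unfolding chi_square_1 cdf_def by (subst measure_distr) auto
  finally show ?thesis .
qed

section \<open>Total variation between normal laws with a common covariance\<close>

text \<open>The columns of \<open>A\<close> are orthonormal for the inverse covariance, so the
  Mahalanobis form becomes the Euclidean one. Taking determinants gives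
  \<open>det S = (det A)\<^sup>2\<close>, so the Jacobian cancels the covariance factor of the
  normalizing constant.\<close>

lemma mvn_density_whitened:
  fixes A S :: "real^'n^'n"
  assumes inv: "invertible S" and A: "transpose A ** matrix_inv S ** A = mat 1"
  shows "det A \<noteq> 0"
    and "\<bar>det A\<bar> * mvn_density m S (m + A *v z) = (\<Prod>b\<in>Basis. std_normal_density (z \<bullet> b))"
proof -
  have "det A * det (matrix_inv S) * det A = 1"
    using arg_cong[OF A, of det] by (simp add: det_mul)
  moreover have "det S * det (matrix_inv S) = 1"
    using arg_cong[OF matrix_inv_right[OF inv], of det] by (simp add: det_mul)
  ultimately have nz: "det A \<noteq> 0" and detS: "det S = (det A)\<^sup>2"
    by (auto simp: power2_eq_square) (metis mult.assoc mult.commute mult.right_neutral)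
  show "det A \<noteq> 0" by (rule nz)
  have quad: "(A *v z) \<bullet> (matrix_inv S *v (A *v z)) = z \<bullet> z"
    by (simp only: inner_matrix_vector_left matrix_vector_mul_assoc matrix_mul_assoc A matrix_vector_mul_lid)
  have "(\<Prod>b\<in>Basis. std_normal_density (z \<bullet> b))
    = (1 / sqrt (2 * pi)) ^ CARD('n) * exp (\<Sum>b\<in>Basis. - (z \<bullet> b)\<^sup>2 / 2)"
    by (simp add: std_normal_density_def exp_sum prod_dividef power_divide)
  also have "(\<Sum>b\<in>Basis. - (z \<bullet> b)\<^sup>2 / 2) = - (z \<bullet> z) / 2"
    by (subst euclidean_inner) (simp add: power2_eq_square sum_negf sum_divide_distrib)
  finally have "(\<Prod>b\<in>Basis. std_normal_density (z \<bullet> b))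
    = (1 / sqrt (2 * pi)) ^ CARD('n) * exp (- (z \<bullet> z) / 2)" .
  moreover have "sqrt ((2 * pi) ^ CARD('n) * det S) = sqrt (2 * pi) ^ CARD('n) * \<bar>det A\<bar>"
    by (simp only: detS real_sqrt_mult[of "(2 * pi) ^ _"] real_sqrt_power[of "2 * pi"] real_sqrt_abs)
  ultimately show "\<bar>det A\<bar> * mvn_density m S (m + A *v z) = (\<Prod>b\<in>Basis. std_normal_density (z \<bullet> b))"
    using nz by (simp add: mvn_density_def quad power_divide)
qed

lemma borel_measurable_mvn_density [measurable]: "mvn_density m S \<in> borel_measurable borel"
  unfolding mvn_density_def[abs_def] by measurable

lemma D_TV_mvn_density:
  fixes S :: "real^'n^'n"
  assumes S: "symmetric_pos_def S" and s: "s > 0"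
    and \<delta>: "\<delta> \<bullet> (matrix_inv S *v \<delta>) = s\<^sup>2"
  shows "D_TV (mvn_density m S) (mvn_density (m + \<delta>) S)
    = measure std_normal_measure {- s / 2<..s / 2}"
proof -
  let ?P = "matrix_inv S"
  let ?\<phi> = std_normal_density
  let ?h = "\<lambda>r. \<bar>mvn_density m S r - mvn_density (m + \<delta>) S r\<bar>"
  have inv: "invertible S" by (rule symmetric_pos_def_invertible[OF S])
  \<comment> \<open>Dividing by \<open>s\<close> gives \<delta> Mahalanobis length 1, so it can be a
    column of a whitening matrix.\<close>
  have "((1 / s) *\<^sub>R \<delta>) \<bullet> (?P *v ((1 / s) *\<^sub>R \<delta>)) = 1"
    using s by (simp add: matrix_vector_mult_scaleR \<delta> power2_eq_square)
  from orthonormal_matrix_extension[OF symmetric_pos_def_matrix_inv[OF S] this]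
  obtain A :: "real^'n^'n" and p where Ap: "A *v axis p 1 = (1 / s) *\<^sub>R \<delta>" and A: "transpose A ** ?P ** A = mat 1"
    by metis
  define e where "e = axis p (1::real)"
  have e: "e \<in> Basis" by (simp add: e_def)
  have det: "det A \<noteq> 0" by (rule mvn_density_whitened(1)[OF inv A])
  have "A *v (s *\<^sub>R e) = \<delta>"
    using s Ap by (simp add: e_def matrix_vector_mult_scaleR)
  then have shift: "m + A *v z = (m + \<delta>) + A *v (z - s *\<^sub>R e)" for z
    by (simp add: matrix_vector_mult_diff_distrib)
  \<comment> \<open>\<open>k b\<close> is the factor of the transformed integrand in coordinate
    \<open>b\<close>: only the direction \<open>e\<close> sees the shift, and all other factors are
    common to both densities.\<close>
  define k where "k b t = (if b = e then \<bar>?\<phi> t - ?\<phi> (t - s)\<bar> else ?\<phi> t)" for b t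
  have k_meas [measurable]: "k b \<in> borel_measurable borel" for b
    unfolding k_def[abs_def] by measurable
  have k_nonneg: "k b t \<ge> 0" for b t by (simp add: k_def)
  have prod: "\<bar>det A\<bar> * ?h (m + A *v z) = (\<Prod>b\<in>Basis. k b (z \<bullet> b))" for z
  proof -
    have "\<bar>det A\<bar> * ?h (m + A *v z)
      = \<bar>\<bar>det A\<bar> * mvn_density m S (m + A *v z)
          - \<bar>det A\<bar> * mvn_density (m + \<delta>) S ((m + \<delta>) + A *v (z - s *\<^sub>R e))\<bar>"
      by (simp add: shift[symmetric] abs_mult right_diff_distrib[symmetric])
    also have "\<dots> = \<bar>(\<Prod>b\<in>Basis. ?\<phi> (z \<bullet> b)) - (\<Prod>b\<in>Basis. ?\<phi> ((z - s *\<^sub>R e) \<bullet> b))\<bar>"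
      by (simp only: mvn_density_whitened(2)[OF inv A])
    also have "(\<Prod>b\<in>Basis. ?\<phi> (z \<bullet> b)) = ?\<phi> (z \<bullet> e) * (\<Prod>b\<in>Basis - {e}. ?\<phi> (z \<bullet> b))"
      by (rule prod.remove) (simp_all add: e)
    also have "(\<Prod>b\<in>Basis. ?\<phi> ((z - s *\<^sub>R e) \<bullet> b))
        = ?\<phi> (z \<bullet> e - s) * (\<Prod>b\<in>Basis - {e}. ?\<phi> (z \<bullet> b))"
      by (subst prod.remove[OF _ e])
        (auto simp: e inner_diff_left inner_Basis intro!: prod.cong split: if_splits)
    also have "\<bar>?\<phi> (z \<bullet> e) * (\<Prod>b\<in>Basis - {e}. ?\<phi> (z \<bullet> b))
        - ?\<phi> (z \<bullet> e - s) * (\<Prod>b\<in>Basis - {e}. ?\<phi> (z \<bullet> b))\<bar>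
      = k e (z \<bullet> e) * (\<Prod>b\<in>Basis - {e}. ?\<phi> (z \<bullet> b))"
      by (simp add: k_def left_diff_distrib[symmetric] abs_mult prod_nonneg)
    also have "(\<Prod>b\<in>Basis - {e}. ?\<phi> (z \<bullet> b)) = (\<Prod>b\<in>Basis - {e}. k b (z \<bullet> b))"
      by (intro prod.cong) (auto simp: k_def)
    also have "k e (z \<bullet> e) * \<dots> = (\<Prod>b\<in>Basis. k b (z \<bullet> b))"
      by (rule prod.remove[symmetric]) (simp_all add: e)
    finally show ?thesis .
  qed
  \<comment> \<open>The translation, the linear substitution and the splitting into factors are
    carried out for nonnegative integrals, free of integrability conditions; the result is converted
    at the end.\<close>
  have "(\<integral>\<^sup>+r. ?h r \<partial>lborel) = (\<integral>\<^sup>+r. ?h (m + r) \<partial>lborel)"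
    by (subst lborel_distr_plus[of m, symmetric]) (simp add: nn_integral_distr)
  also have "\<dots> = ennreal \<bar>det A\<bar> * (\<integral>\<^sup>+z. ?h (m + A *v z) \<partial>lborel)"
    by (rule nn_integral_lborel_matrix[OF det, symmetric]) measurable
  also have "\<dots> = (\<integral>\<^sup>+z. ennreal (\<bar>det A\<bar> * ?h (m + A *v z)) \<partial>lborel)"
    by (simp add: ennreal_mult nn_integral_cmult)
  also have "\<dots> = (\<integral>\<^sup>+z. (\<Prod>b\<in>Basis. ennreal (k b (z \<bullet> b))) \<partial>lborel)"
    by (simp only: prod) (simp add: prod_ennreal k_nonneg)
  also have "\<dots> = (\<Prod>b\<in>(Basis :: (real^'n) set). \<integral>\<^sup>+t. ennreal (k b t) \<partial>lborel)"
    by (rule nn_integral_lborel_prod) auto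
  also have "\<dots> = (\<integral>\<^sup>+t. \<bar>?\<phi> t - ?\<phi> (t - s)\<bar> \<partial>lborel)
      * (\<Prod>b\<in>(Basis :: (real^'n) set) - {e}. \<integral>\<^sup>+t. ennreal (?\<phi> t) \<partial>lborel)"
    by (subst prod.remove[OF _ e]) (auto simp: k_def intro!: arg_cong2[where f = "(*)"] prod.cong)
  also have "(\<integral>\<^sup>+t. ennreal (?\<phi> t) \<partial>lborel) = 1"
    by (simp add: nn_integral_eq_integral integrable_normal_density integral_normal_density)
  also have "(\<integral>\<^sup>+t. \<bar>?\<phi> t - ?\<phi> (t - s)\<bar> \<partial>lborel)
      = ennreal (2 * measure std_normal_measure {- s / 2<..s / 2})"
    by (simp add: nn_integral_eq_integral integrable_abs_std_normal_shift[OF s]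
        integral_abs_std_normal_shift[OF s])
  finally have "(LINT r|lborel. ?h r) = 2 * measure std_normal_measure {- s / 2<..s / 2}"
    by (simp add: integral_eq_nn_integral)
  then show ?thesis by (simp add: D_TV_def)
qed

section \<open>Block structure of the covariance matrix\<close>

lemma sum_UNIV_Plus:
  "(\<Sum>p\<in>(UNIV :: ('a::finite + 'b::finite) set). h p) = (\<Sum>i\<in>UNIV. h (Inl i)) + (\<Sum>j\<in>UNIV. h (Inr j))"
  by (simp add: UNIV_Plus_UNIV[symmetric] sum.Plus del: UNIV_Plus_UNIV)

lemma inner_stack: "stack u v \<bullet> y = u \<bullet> (\<chi> i. y $ Inl i) + v \<bullet> (\<chi> i. y $ Inr i)"
  by (simp add: inner_vec_def sum_UNIV_Plus stack_def)

lemma block11_mult: "block11 S *v x = (\<chi> i. (S *v stack x 0) $ Inl i)"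
  by (simp add: matrix_vector_mult_def block11_def stack_def sum_UNIV_Plus vec_eq_iff)

text \<open>Testing the full matrix on vectors with zero lower half yields both the positive
  definiteness of the upper left block and the Mahalanobis norm of the mean shift chosen
  later.\<close>

lemma inner_block11: "x \<bullet> (block11 S *v x) = stack x 0 \<bullet> (S *v stack x 0)"
  by (simp add: inner_stack block11_mult)

lemma symmetric_pos_def_block11:
  assumes "symmetric_pos_def S" shows "symmetric_pos_def (block11 S)"
  unfolding symmetric_pos_def_def inner_block11
proof (intro conjI allI impI)
  show "transpose (block11 S) = block11 S"
    using assms by (simp add: symmetric_pos_def_def transpose_def block11_def vec_eq_iff)
  fix x :: "real^'a" assume "x \<noteq> 0"
  then obtain i where "x $ i \<noteq> 0" by (auto simp: vec_eq_iff)
  then have "stack x 0 $ Inl i \<noteq> 0" by (simp add: stack_def)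
  then have "stack x 0 \<noteq> 0" by force
  then show "stack x 0 \<bullet> (S *v stack x 0) > 0"
    using assms by (simp add: symmetric_pos_def_def)
qed

section \<open>Choice of the two means and conclusion\<close>

theorem lemma1:
  fixes S0 :: "real ^ ('k::finite + 'k) ^ ('k + 'k)" and d :: real
  assumes "symmetric_pos_def S0" and "d > 0"
  shows "(INF (f, g) \<in> C0 S0 \<times> C1 S0 d. D_TV f g) \<le> cdf (chi_square 1) (d / 4)"
proof -
  let ?S11 = "block11 S0"
  have spd11: "symmetric_pos_def ?S11" by (rule symmetric_pos_def_block11[OF assms(1)])
  \<comment> \<open>Any nonzero vector will do, hence the arbitrary index \<open>undefined\<close>;
    rescaling then gives the quadratic form the value \<open>d\<close>.\<close>
  obtain e :: "real^'k" where "e \<noteq> 0" using axis_eq_0_iff[of undefined "1::real"] by blast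
  then have q: "e \<bullet> (?S11 *v e) > 0" using spd11 by (simp add: symmetric_pos_def_def)
  define x where "x = sqrt (d / (e \<bullet> (?S11 *v e))) *\<^sub>R e"
  have x: "x \<bullet> (?S11 *v x) = d"
    using q assms(2) by (simp add: x_def matrix_vector_mult_scaleR flip: mult.assoc real_sqrt_mult)
  \<comment> \<open>Among all vectors with upper half \<open>v\<close>, this one has the least
    Mahalanobis norm; its lower half \<open>w\<close> is the regression of the lower block on the
    upper one.\<close>
  define \<delta> where "\<delta> = S0 *v stack x 0"
  define v where "v = ?S11 *v x"
  define w where "w = (\<chi> i. \<delta> $ Inr i)"
  have \<delta>: "\<delta> = stack v w"
    by (auto simp: v_def w_def \<delta>_def block11_mult stack_def vec_eq_iff split: sum.split)
  have "\<delta> \<bullet> (matrix_inv S0 *v \<delta>) = d"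
    using x by (simp add: \<delta>_def matrix_inv_vector_mult symmetric_pos_def_invertible[OF assms(1)]
        inner_block11 inner_commute)
  then have "D_TV (mvn_density m S0) (mvn_density (m + \<delta>) S0) \<le> cdf (chi_square 1) (d / 4)" for m
    using D_TV_mvn_density[OF assms(1), of "sqrt d" \<delta> m] measure_le_cdf_chi_square_1[of "sqrt d"] assms(2)
    by simp
  \<comment> \<open>The null mean is free in its lower half, so \<open>v - w\<close> can absorb the
    lower half of the shift.\<close>
  moreover have "stack 0 (v - w) + \<delta> = stack (1 *\<^sub>R v) v"
    by (auto simp: \<delta> stack_def vec_eq_iff split: sum.split)
  ultimately have le: "D_TV (phi S0 0 (v - w)) (phi S0 1 v) \<le> cdf (chi_square 1) (d / 4)"
    unfolding phi_def by (metis scaleR_zero_left)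
  \<comment> \<open>A single density is a mixture with \<open>m = 1\<close> and weight 1.\<close>
  have f: "phi S0 0 (v - w) \<in> C0 S0"
    unfolding C0_def
    by (rule CollectI, intro exI[of _ 1] exI[of _ "\<lambda>_. 1"] exI[of _ "\<lambda>_. v - w"]) simp
  \<comment> \<open>With \<open>\<Delta> = 1\<close> the separation constraint therefore holds with
    equality.\<close>
  have "v \<bullet> (matrix_inv ?S11 *v v) = d"
    using x by (simp add: v_def matrix_inv_vector_mult symmetric_pos_def_invertible[OF spd11] inner_commute)
  then have g: "phi S0 1 v \<in> C1 S0 d"
    unfolding C1_def
    by (intro CollectI exI[of _ 1] exI[of _ "\<lambda>_. 1"] exI[of _ "\<lambda>_. v"]) simp
  \<comment> \<open>A real infimum is a lower bound only for a set bounded below; here 0 works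
    because the integrand is nonnegative.\<close>
  have "bdd_below ((\<lambda>(f, g). D_TV f g) ` (C0 S0 \<times> C1 S0 d))"
    by (rule bdd_belowI[of _ 0]) (auto simp: D_TV_def)
  from cINF_lower[OF this, of "(phi S0 0 (v - w), phi S0 1 v)"] f g le
  show ?thesis by simp
qed

end
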